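(* Let $\mathbb{H}_1,\mathbb{H}_2$ be real Hilbert spaces such that $\dim(\mathbb{H}_2)>1$. Suppose $T\in S_{\mathbb{L}(\mathbb{H}_1,\mathbb{H}_2)}$ is such that $M_T=S_{H_0}$, where $H_0$ is a subspace of $\mathbb{H}_1$. Then the following are equivalent: (a) for every $\epsilon>0$, $T$ admits a non-trivial uniform $\epsilon$-BPB approximation $A_\epsilon$ such that $M_T=M_{A_\epsilon}$; (b) $\|T\|_{H_0^\perp}<1$.
   Context: $\mathbb{L}(\mathbb{H}_1,\mathbb{H}_2)$ is the space of bounded linear operators with the operator norm; $S_Z$ is the unit sphere of a normed space $Z$. For a subspace $Z$ of $\mathbb{H}_1$, $\|T\|_Z$ is the operator norm of the restriction of $T$ to $Z$ (equal to $0$ if $Z=\{0\}$). For an operator $A$, $M_A=\{x\in S_{\mathbb{H}_1}:\|Ax\|=\|A\|\}$. For $T\in S_{\mathbb{L}(\mathbb{H}_1,\mathbb{H}_2)}$ and $\epsilon>0$, an operator $A\in S_{\mathbb{L}(\mathbb{H}_1,\mathbb{H}_2)}$ is a uniform $\epsilon$-BPB approximation of $T$ if $\|T-A\|<\epsilon$ and there exists $\delta(\epsilon)>0$ such that for each $x_0\in S_{\mathbb{H}_1}$ with $\|Tx_0\|>1-\delta(\epsilon)$ there exists $u_0\in M_A$ with $\|u_0-x_0\|<\epsilon$. It is non-trivial if in addition $A\neq T$. *)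

theory Defs
  imports "HOL-Analysis.Analysis"
begin

definition norm_attaining_set :: "('a::real_normed_vector \<Rightarrow>\<^sub>L 'b::real_normed_vector) \<Rightarrow> 'a set"
  where "norm_attaining_set A = {x \<in> sphere 0 1. norm (blinfun_apply A x) = norm A}"

text \<open>The quotient form follows the library's \<open>onorm\<close>, with the supremum restricted to \<open>Z\<close>.
  As division by zero yields zero, the value for \<open>Z = {0}\<close> is 0.\<close>

definition restriction_norm ::
    "('a::real_normed_vector \<Rightarrow>\<^sub>L 'b::real_normed_vector) \<Rightarrow> 'a set \<Rightarrow> real"
  where "restriction_norm T Z = (SUP z\<in>Z. norm (blinfun_apply T z) / norm z)"

definition uniform_BPB_approx ::
    "real \<Rightarrow> ('a::real_normed_vector \<Rightarrow>\<^sub>L 'b::real_normed_vector) \<Rightarrow> ('a \<Rightarrow>\<^sub>L 'b) \<Rightarrow> bool"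
  where "uniform_BPB_approx \<epsilon> T A \<longleftrightarrow>
    A \<in> sphere 0 1 \<and> norm (T - A) < \<epsilon> \<and>
    (\<exists>\<delta>>0. \<forall>x\<^sub>0\<in>sphere 0 1. norm (blinfun_apply T x\<^sub>0) > 1 - \<delta> \<longrightarrow>
      (\<exists>u\<^sub>0\<in>norm_attaining_set A. norm (u\<^sub>0 - x\<^sub>0) < \<epsilon>))"

definition nontrivial_uniform_BPB_approx ::
    "real \<Rightarrow> ('a::real_normed_vector \<Rightarrow>\<^sub>L 'b::real_normed_vector) \<Rightarrow> ('a \<Rightarrow>\<^sub>L 'b) \<Rightarrow> bool"
  where "nontrivial_uniform_BPB_approx \<epsilon> T A \<longleftrightarrow> uniform_BPB_approx \<epsilon> T A \<and> A \<noteq> T"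

end

theory Submission
  imports Defs
begin

text \<open>If \<open>\<parallel>T\<parallel>\<close> restricted to \<open>H\<^sub>0\<^sup>\<bottom>\<close> is less than 1, compose \<open>T\<close> with a rotation of \<open>\<bbbH>\<^sub>2\<close> by a small
  nonzero angle in a plane through some \<open>T h\<close>, \<open>h \<in> M\<^sub>T\<close>: this changes \<open>T\<close> but not \<open>M\<^sub>T\<close>. A
  contraction preserving the norm of \<open>p\<close> maps \<open>p\<^sup>\<bottom>\<close> into \<open>(T p)\<^sup>\<bottom>\<close>, so \<open>\<parallel>T x\<parallel>\<close> close to 1 forces the
  component of \<open>x\<close> in \<open>H\<^sub>0\<^sup>\<bottom>\<close> to be small. Conversely, unit vectors of \<open>H\<^sub>0\<close> and \<open>H\<^sub>0\<^sup>\<bottom>\<close> are at distance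
  \<open>\<surd>2\<close>, so no unit vector of \<open>H\<^sub>0\<^sup>\<bottom>\<close> can almost attain the norm.\<close>

section \<open>Orthogonal projection onto closed subspaces\<close>

lemma eq_0_if_linear_le_quadratic:
  fixes c K :: real
  assumes "\<And>s. s * c \<le> s\<^sup>2 * K"
  shows "c = 0"
proof (rule ccontr)
  assume "c \<noteq> 0"
  \<comment> \<open>Any positive \<open>L\<close> above \<open>K\<close> works: at
    \<open>s = c / L\<close> the hypothesis forces \<open>1 \<le> K / L\<close>.\<close>
  define L where "L = \<bar>K\<bar> + 1"
  have L: "L > 0" "K < L" by (auto simp: L_def)
  have "c\<^sup>2 / L \<le> (c\<^sup>2 / L) * (K / L)"
    using assms[of "c / L"] by (simp add: power2_eq_square)
  moreover have "c\<^sup>2 / L > 0" using L \<open>c \<noteq> 0\<close> by simp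
  ultimately have "1 \<le> K / L" by (metis mult.right_neutral mult_le_cancel_left_pos)
  then show False using L by (simp add: divide_simps)
qed

lemma norm_add_scaleR_squared:
  fixes p q :: "'a::real_inner"
  shows "(norm (p + s *\<^sub>R q))\<^sup>2 = (norm p)\<^sup>2 + 2 * s * (p \<bullet> q) + s\<^sup>2 * (norm q)\<^sup>2"
  unfolding power2_norm_eq_inner
  by (simp add: inner_simps inner_commute power2_eq_square algebra_simps)

text \<open>First variation: moving \<open>p\<close> by \<open>s\<close> times a vector of
  \<open>S\<close> cannot reduce the squared distance to \<open>x\<close>, so the linear term in
  \<open>s\<close> must vanish.\<close>

lemma nearest_point_orthogonal:
  fixes S :: "'a::real_inner set"
  assumes "subspace S" "p \<in> S" "\<And>y. y \<in> S \<Longrightarrow> dist x p \<le> dist x y"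
  shows "x - p \<in> S\<^sup>\<bottom>"
proof -
  have "y \<bullet> (x - p) = 0" if "y \<in> S" for y
  proof -
    have "s * (2 * ((x - p) \<bullet> y)) \<le> s\<^sup>2 * (norm y)\<^sup>2" for s
    proof -
      have "p + s *\<^sub>R y \<in> S" using assms that by (simp add: subspace_add subspace_scale)
      then have "norm (x - p) \<le> norm (x - p + (- s) *\<^sub>R y)"
        using assms(3) by (fastforce simp: dist_norm algebra_simps)
      then have "(norm (x - p))\<^sup>2 \<le> (norm (x - p + (- s) *\<^sub>R y))\<^sup>2" by simp
      then show ?thesis unfolding norm_add_scaleR_squared by simp
    qed
    then have "2 * ((x - p) \<bullet> y) = 0" by (rule eq_0_if_linear_le_quadratic)
    then show ?thesis by (simp add: inner_commute)
  qed
  then show ?thesis by (auto simp: orthogonal_comp_def orthogonal_def)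
qed

text \<open>The midpoint of \<open>y\<close> and \<open>z\<close> lies in \<open>S\<close>, hence is
  no closer to \<open>x\<close> than the infimum; the parallelogram law turns this into a bound on
  the distance of \<open>y\<close> and \<open>z\<close>. It provides the Cauchy estimate for
  minimising sequences.\<close>

lemma dist_near_minimisers:
  fixes S :: "'a::real_inner set"
  assumes "subspace S" "y \<in> S" "z \<in> S"
    and "dist x y \<le> infdist x S + h" "dist x z \<le> infdist x S + h" "0 \<le> h" "h \<le> 1"
  shows "(dist y z)\<^sup>2 \<le> 4 * h * (2 * infdist x S + 1)"
proof -
  let ?d = "infdist x S"
  have "(1/2) *\<^sub>R (y + z) \<in> S" using assms by (simp add: subspace_add subspace_scale)
  then have "?d \<le> norm (x - (1/2) *\<^sub>R (y + z))" by (metis infdist_le dist_norm)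
  then have m: "?d\<^sup>2 \<le> (norm (x - (1/2) *\<^sub>R (y + z)))\<^sup>2"
    by (simp add: infdist_nonneg)
  have b: "(norm (x - y))\<^sup>2 \<le> (?d + h)\<^sup>2" "(norm (x - z))\<^sup>2 \<le> (?d + h)\<^sup>2"
    using assms by (auto simp: dist_norm intro!: power_mono)
  have "(norm (y - z))\<^sup>2 = 2 * (norm (x - y))\<^sup>2 + 2 * (norm (x - z))\<^sup>2
      - 4 * (norm (x - (1/2) *\<^sub>R (y + z)))\<^sup>2"
    by (simp add: power2_norm_eq_inner inner_simps inner_commute add_divide_distrib)
  also have "\<dots> \<le> 4 * (?d + h)\<^sup>2 - 4 * ?d\<^sup>2" using m b by linarith
  also have "\<dots> = 4 * h * (2 * ?d + h)" by (simp add: power2_eq_square algebra_simps)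
  also have "\<dots> \<le> 4 * h * (2 * ?d + 1)" using assms by (intro mult_left_mono) auto
  finally show ?thesis by (simp add: dist_norm)
qed

text \<open>Cantor intersection: the sets \<open>F n\<close> of near-minimisers are closed, nonempty
  and decreasing, and their diameters tend to 0, so completeness yields a common point, which is a
  nearest point.\<close>

lemma orthogonal_projection_exists:
  fixes S :: "'a::{real_inner, complete_space} set"
  assumes "subspace S" "closed S"
  shows "\<exists>p\<in>S. x - p \<in> S\<^sup>\<bottom>"
proof -
  let ?d = "infdist x S" and ?h = "\<lambda>n. 1 / real (Suc n)"
  define F where "F n = S \<inter> cball x (?d + ?h n)" for n
  have ne: "S \<noteq> {}" using assms(1) by (auto simp: subspace_def)
  obtain p where p: "\<And>n. p \<in> F n"
  proof (rule decreasing_closed_nest[of F])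
    show "closed (F n)" for n using assms by (auto simp: F_def)
    show "F n \<noteq> {}" for n
    proof -
      have "(INF a\<in>S. dist x a) < ?d + ?h n" using ne by (simp add: infdist_notempty)
      then obtain a where "a \<in> S" "dist x a < ?d + ?h n"
        using ne by (auto simp: cINF_less_iff)
      then have "a \<in> F n" by (simp add: F_def)
      then show ?thesis by blast
    qed
    show "F n \<subseteq> F m" if "m \<le> n" for m n
    proof -
      have "?h n \<le> ?h m" using that by (simp add: frac_le)
      then show ?thesis by (auto simp: F_def)
    qed
    show "\<exists>n. \<forall>y\<in>F n. \<forall>z\<in>F n. dist y z < e" if "e > 0" for e
    proof -
      have d: "2 * ?d + 1 > 0" using infdist_nonneg[of x S] by linarith
      then have "e\<^sup>2 / (4 * (2 * ?d + 1)) > 0" using that by simp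
      then obtain n where "?h n < e\<^sup>2 / (4 * (2 * ?d + 1))" using nat_approx_posE by blast
      then have n: "4 * ?h n * (2 * ?d + 1) < e\<^sup>2" using d by (simp add: field_simps)
      have "dist y z < e" if "y \<in> F n" "z \<in> F n" for y z
      proof -
        have "(dist y z)\<^sup>2 \<le> 4 * ?h n * (2 * ?d + 1)"
          using that assms by (intro dist_near_minimisers) (auto simp: F_def)
        then have "(dist y z)\<^sup>2 < e\<^sup>2" using n by linarith
        then show ?thesis using \<open>e > 0\<close> by (simp add: power_less_imp_less_base)
      qed
      then show ?thesis by blast
    qed
  qed blast
  have "p \<in> S" using p by (simp add: F_def)
  have "dist x p \<le> ?d + e" if e: "e > 0" for e
  proof -
    obtain n where "?h n < e" using e by (rule nat_approx_posE)
    then show ?thesis using p[of n] by (auto simp: F_def)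
  qed
  then have "dist x p \<le> ?d" by (rule field_le_epsilon)
  then have "dist x p \<le> dist x y" if "y \<in> S" for y
    using infdist_le[OF that, of x] by linarith
  then show ?thesis using nearest_point_orthogonal \<open>p \<in> S\<close> assms by blast
qed

text \<open>Expand \<open>norm (T (p + s *\<^sub>R q)) \<le> norm (p + s *\<^sub>R q)\<close> after
  squaring. The squared norms of \<open>p\<close> and \<open>T p\<close> cancel and
  \<open>p \<bullet> q\<close> is 0, so a linear term in \<open>s\<close> is bounded by a quadratic
  one for both signs of \<open>s\<close>.\<close>

lemma contraction_orthogonal_image:
  fixes T :: "'a::real_inner \<Rightarrow>\<^sub>L 'b::real_inner"
  assumes "norm T \<le> 1" "norm (T p) = norm p" "p \<bullet> q = 0"
  shows "T p \<bullet> T q = 0"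
proof -
  have "s * (2 * (T p \<bullet> T q)) \<le> s\<^sup>2 * ((norm q)\<^sup>2 - (norm (T q))\<^sup>2)" for s
  proof -
    have "norm (T (p + s *\<^sub>R q)) \<le> norm (p + s *\<^sub>R q)"
      using norm_blinfun[of T "p + s *\<^sub>R q"] mult_right_mono[OF assms(1) norm_ge_zero]
      by (metis mult_1 order_trans)
    then have "(norm (T p + s *\<^sub>R T q))\<^sup>2 \<le> (norm (p + s *\<^sub>R q))\<^sup>2"
      by (simp add: blinfun.bilinear_simps)
    then show ?thesis
      unfolding norm_add_scaleR_squared using assms by (simp add: algebra_simps)
  qed
  then have "2 * (T p \<bullet> T q) = 0" by (rule eq_0_if_linear_le_quadratic)
  then show ?thesis by simp
qed

section \<open>Small rotations in a plane\<close>

lemma exists_orthogonal_unit: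
  fixes e :: "'b::real_inner"
  assumes "\<exists>B::'b set. independent B \<and> card B > 1" "norm e = 1"
  shows "\<exists>f. norm f = 1 \<and> e \<bullet> f = 0"
proof -
  obtain B :: "'b set" where B: "independent B" "card B > 1" using assms by blast
  have "\<not> B \<subseteq> span {e}"
  proof
    assume "B \<subseteq> span {e}"
    then have "card B \<le> card {e}" using B(1) independent_span_bound[of "{e}" B] by simp
    then show False using B(2) by simp
  qed
  then obtain b where b: "b \<notin> span {e}" by blast
  define g where "g = b - (b \<bullet> e) *\<^sub>R e"
  have "g \<noteq> 0" using b by (auto simp: g_def span_singleton)
  moreover have "e \<bullet> g = 0"
    using assms(2) by (simp add: g_def inner_simps inner_commute norm_eq_1)
  ultimately show ?thesis by (intro exI[of _ "g /\<^sub>R norm g"]) simp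
qed

lemma small_rotation:
  fixes e :: "'b::real_inner"
  assumes "\<exists>B::'b set. independent B \<and> card B > 1" "norm e = 1" "t > 0"
  shows "\<exists>R. bounded_linear R \<and> (\<forall>y. norm (R y) = norm y) \<and>
    (\<forall>y. norm (R y - y) \<le> t * norm y) \<and> R e \<noteq> e"
proof -
  obtain f where f: "norm f = 1" "e \<bullet> f = 0" using exists_orthogonal_unit assms by blast
  have on: "e \<bullet> e = 1" "f \<bullet> f = 1" "e \<bullet> f = 0" "f \<bullet> e = 0"
    using f assms by (auto simp: norm_eq_1 inner_commute)
  \<comment> \<open>The rotation angle. The cap at 1 keeps \<open>sin u\<close> positive, which
    later gives \<open>R e \<noteq> e\<close>.\<close>
  define u where "u = min t 1"
  have u: "0 < u" "u \<le> t" "u \<le> 1" using assms by (auto simp: u_def)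
  define c s where "c = cos u" and "s = sin u"
  have cs: "c\<^sup>2 + s\<^sup>2 = 1" by (simp add: c_def s_def)
  have "s > 0" using u by (simp add: s_def sin_gt_zero_02)
  \<comment> \<open>Half-angle formula: \<open>2 - 2 * cos u\<close> is four times the square of
    \<open>sin (u / 2)\<close>.\<close>
  have c: "2 - 2 * c \<le> u\<^sup>2"
  proof -
    have "\<bar>sin (u / 2)\<bar> \<le> \<bar>u / 2\<bar>" by (rule abs_sin_x_le_abs_x)
    then have "(sin (u / 2))\<^sup>2 \<le> (u / 2)\<^sup>2" by (simp only: abs_le_square_iff)
    then show ?thesis using cos_double_sin[of "u / 2"] by (simp add: c_def power_divide)
  qed
  \<comment> \<open>Rotation by \<open>u\<close> in the plane of \<open>e\<close> and
    \<open>f\<close>, identity on its orthogonal complement, written as the identity plus a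
    correction in the plane.\<close>
  define R where "R y = y + (((c - 1) * (y \<bullet> e) - s * (y \<bullet> f)) *\<^sub>R e
    + (s * (y \<bullet> e) + (c - 1) * (y \<bullet> f)) *\<^sub>R f)" for y
  have lin: "bounded_linear R"
    unfolding R_def by (intro bounded_linear_intros)
  have bessel: "(y \<bullet> e)\<^sup>2 + (y \<bullet> f)\<^sup>2 \<le> (norm y)\<^sup>2" for y
  proof -
    have "0 \<le> (norm (y - (y \<bullet> e) *\<^sub>R e - (y \<bullet> f) *\<^sub>R f))\<^sup>2" by simp
    also have "\<dots> = (norm y)\<^sup>2 - (y \<bullet> e)\<^sup>2 - (y \<bullet> f)\<^sup>2"
      unfolding power2_norm_eq_inner
      by (simp add: inner_simps on inner_commute power2_eq_square algebra_simps)
    finally show ?thesis by simp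
  qed
  have plane: "(norm (a *\<^sub>R e + b *\<^sub>R f))\<^sup>2 = a\<^sup>2 + b\<^sup>2" for a b
    unfolding power2_norm_eq_inner by (simp add: inner_simps on power2_eq_square)
  have diff: "(norm (R y - y))\<^sup>2 = (2 - 2 * c) * ((y \<bullet> e)\<^sup>2 + (y \<bullet> f)\<^sup>2)" for y
  proof -
    have "(norm (R y - y))\<^sup>2 = ((c - 1) * (y \<bullet> e) - s * (y \<bullet> f))\<^sup>2
      + (s * (y \<bullet> e) + (c - 1) * (y \<bullet> f))\<^sup>2"
      unfolding R_def by (simp add: plane)
    also have "\<dots> = (c\<^sup>2 + s\<^sup>2 + 1 - 2 * c) * ((y \<bullet> e)\<^sup>2 + (y \<bullet> f)\<^sup>2)" by algebra
    finally show ?thesis using cs by simp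
  qed
  \<comment> \<open>The cross term contributes \<open>2 * (c - 1)\<close> times the squared length
    of the planar part of \<open>y\<close>, which cancels \<open>diff\<close>.\<close>
  have iso: "norm (R y) = norm y" for y
  proof -
    have "(norm (R y))\<^sup>2 = (norm y)\<^sup>2 + 2 * (y \<bullet> (R y - y)) + (norm (R y - y))\<^sup>2"
      using norm_add_scaleR_squared[of y 1 "R y - y"] by simp
    moreover have "y \<bullet> (R y - y) = (c - 1) * ((y \<bullet> e)\<^sup>2 + (y \<bullet> f)\<^sup>2)"
      unfolding R_def by (simp add: inner_simps power2_eq_square algebra_simps)
    ultimately have "(norm (R y))\<^sup>2 = (norm y)\<^sup>2" using diff[of y] by algebra
    then show ?thesis by simp
  qed
  have near: "norm (R y - y) \<le> t * norm y" for y
  proof -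
    have "(norm (R y - y))\<^sup>2 \<le> (u * norm y)\<^sup>2"
      unfolding diff power_mult_distrib using c bessel by (intro mult_mono) auto
    then have "norm (R y - y) \<le> u * norm y"
      by (rule power2_le_imp_le) (use u in simp)
    also have "\<dots> \<le> t * norm y" using u by (intro mult_right_mono) auto
    finally show ?thesis .
  qed
  have "(R e - e) \<bullet> f = s" unfolding R_def by (simp add: inner_simps on)
  then have "R e \<noteq> e" using \<open>s > 0\<close> by auto
  then show ?thesis using lin iso near by blast
qed

section \<open>Restriction norms and norm attainment\<close>

lemma norm_le_restriction_norm:
  assumes "z \<in> Z"
  shows "norm (blinfun_apply T z) \<le> restriction_norm T Z * norm z"
proof (cases "z = 0")
  case False
  \<comment> \<open>The supremum is over reals, so an upper bound for the quotients is needed first;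
    the operator norm is one.\<close>
  have "norm (T z) / norm z \<le> norm T" for z
    by (cases "z = 0") (auto simp: divide_simps norm_blinfun)
  then have "bdd_above ((\<lambda>z. norm (T z) / norm z) ` Z)" by (rule bdd_aboveI2)
  then have "norm (T z) / norm z \<le> restriction_norm T Z"
    unfolding restriction_norm_def using assms by (intro cSUP_upper)
  then show ?thesis using False by (simp add: divide_simps)
qed (simp add: blinfun.bilinear_simps)

lemma restriction_norm_le:
  assumes "subspace Z" "0 \<le> r" "\<And>z. z \<in> Z \<Longrightarrow> norm z = 1 \<Longrightarrow> norm (blinfun_apply T z) \<le> r"
  shows "restriction_norm T Z \<le> r"
  unfolding restriction_norm_def
proof (rule cSUP_least)
  show "Z \<noteq> {}" using assms(1) by (auto simp: subspace_def)
  show "norm (T z) / norm z \<le> r" if "z \<in> Z" for z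
  proof (cases "z = 0")
    case False
    then have "norm (T (z /\<^sub>R norm z)) \<le> r"
      using that assms by (intro assms(3)) (auto simp: subspace_scale)
    then show ?thesis by (simp add: blinfun.bilinear_simps divide_inverse mult.commute)
  \<comment> \<open>At \<open>z = 0\<close> the quotient is 0, so \<open>0 \<le> r\<close> settles
    this case.\<close>
  qed (use assms in simp)
qed

text \<open>Norm attainment is homogeneous, so the description of the norm-attaining set extends
  from the sphere to all vectors. This exhibits \<open>H\<close> as the solution set of a continuous
  equation.\<close>

lemma norm_attained_iff:
  assumes "norm T = 1" "subspace H" "norm_attaining_set T = sphere 0 1 \<inter> H"
  shows "x \<in> H \<longleftrightarrow> norm (blinfun_apply T x) = norm x"
proof (cases "x = 0")
  case False
  have "x \<in> H \<longleftrightarrow> x /\<^sub>R norm x \<in> H"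
    using False subspace_scale[OF assms(2), of x "inverse (norm x)"]
      subspace_scale[OF assms(2), of "x /\<^sub>R norm x" "norm x"] by auto
  also have "\<dots> \<longleftrightarrow> x /\<^sub>R norm x \<in> norm_attaining_set T" using assms(3) False by auto
  also have "\<dots> \<longleftrightarrow> norm (T x) = norm x"
    using False assms(1) by (auto simp: norm_attaining_set_def blinfun.bilinear_simps field_simps)
  finally show ?thesis .
qed (use assms in \<open>auto simp: subspace_0 blinfun.bilinear_simps\<close>)

section \<open>The two implications\<close>

lemma restriction_norm_less_1_if_uniform_BPB:
  fixes T A :: "'a::real_inner \<Rightarrow>\<^sub>L 'b::real_normed_vector"
  assumes "uniform_BPB_approx 1 T A" "norm_attaining_set A \<subseteq> H"
  shows "restriction_norm T (H\<^sup>\<bottom>) < 1"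
proof -
  obtain \<delta> where \<delta>: "\<delta> > 0" "\<And>x. norm x = 1 \<Longrightarrow> norm (T x) > 1 - \<delta> \<Longrightarrow>
      \<exists>u\<in>norm_attaining_set A. norm (u - x) < 1"
    using assms(1) unfolding uniform_BPB_approx_def by auto
  have "norm (T z) \<le> 1 - \<delta>" if z: "z \<in> H\<^sup>\<bottom>" "norm z = 1" for z
  proof (rule ccontr)
    assume "\<not> ?thesis"
    then obtain u where u: "u \<in> norm_attaining_set A" "norm (u - z) < 1" using \<delta> z by force
    have "norm u = 1" "u \<bullet> z = 0"
      using u z assms(2) by (auto simp: norm_attaining_set_def orthogonal_comp_def orthogonal_def)
    then have "(norm (u - z))\<^sup>2 = 2" using z norm_add_scaleR_squared[of u "-1" z] by simp
    moreover have "(norm (u - z))\<^sup>2 < 1" using u by (simp add: power_less_one_iff)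
    ultimately show False by simp
  qed
  \<comment> \<open>The maximum with 0 keeps the bound nonnegative even if \<open>\<delta>\<close>
    exceeds 1.\<close>
  then have "restriction_norm T (H\<^sup>\<bottom>) \<le> max 0 (1 - \<delta>)"
    by (intro restriction_norm_le subspace_orthogonal_comp) (auto intro: max.coboundedI2)
  then show ?thesis using \<delta> by simp
qed

text \<open>Write \<open>x = p + q\<close> along \<open>H\<close> and its complement. Pythagoras
  before and after applying \<open>T\<close> bounds the square of \<open>norm (T x)\<close> by 1
  minus \<open>1 - r\<^sup>2\<close> times the square of \<open>norm q\<close>. So near attainment
  makes \<open>q\<close> small, and normalising \<open>p\<close> gives \<open>u\<close>.\<close>

lemma near_norm_attaining:
  fixes T :: "'a::{real_inner, complete_space} \<Rightarrow>\<^sub>L 'b::real_inner"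
  assumes "norm T = 1" "subspace H" "norm_attaining_set T = sphere 0 1 \<inter> H"
    and "restriction_norm T (H\<^sup>\<bottom>) < 1" "\<epsilon> > 0"
  shows "\<exists>\<delta>>0. \<forall>x\<in>sphere 0 1. norm (T x) > 1 - \<delta> \<longrightarrow>
    (\<exists>u\<in>norm_attaining_set T. norm (u - x) < \<epsilon>)"
proof -
  note H_iff = norm_attained_iff[OF assms(1-3)]
  have "H = {x. norm (T x) = norm x}" using H_iff by auto
  then have "closed H" by (auto intro!: closed_Collect_eq continuous_intros)
  define r where "r = max 0 (restriction_norm T (H\<^sup>\<bottom>))"
  have r: "0 \<le> r" "r < 1" using assms(4) by (auto simp: r_def)
  then have r2: "1 - r\<^sup>2 > 0" by (simp add: power_less_one_iff abs_square_less_1)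
  \<comment> \<open>Target bound for \<open>norm q\<close>: half of \<open>\<epsilon>\<close>
    because \<open>u\<close> is within \<open>2 * norm q\<close> of \<open>x\<close>, and at most
    1/2 so that \<open>p\<close> is nonzero.\<close>
  define \<eta> where "\<eta> = min (\<epsilon> / 2) (1 / 2)"
  have \<eta>: "0 < \<eta>" "\<eta> \<le> \<epsilon> / 2" "\<eta> \<le> 1 / 2" using assms(5) by (auto simp: \<eta>_def)
  \<comment> \<open>Chosen so that \<open>2 * \<delta>\<close>, the loss on squaring
    \<open>1 - \<delta>\<close>, is at most \<open>(1 - r\<^sup>2) * \<eta>\<^sup>2\<close>; the cap
    at 1 keeps \<open>1 - \<delta>\<close> nonnegative for squaring.\<close>
  define \<delta> where "\<delta> = min 1 ((1 - r\<^sup>2) * \<eta>\<^sup>2 / 2)"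
  have \<delta>: "\<delta> > 0" "\<delta> \<le> 1" "2 * \<delta> \<le> (1 - r\<^sup>2) * \<eta>\<^sup>2" using r2 \<eta> by (auto simp: \<delta>_def)
  have "\<exists>u\<in>norm_attaining_set T. norm (u - x) < \<epsilon>"
    if x: "norm x = 1" "norm (T x) > 1 - \<delta>" for x
  proof -
    obtain p where p: "p \<in> H" "x - p \<in> H\<^sup>\<bottom>"
      using orthogonal_projection_exists[OF assms(2) \<open>closed H\<close>] by blast
    define q where "q = x - p"
    have x_eq: "x = p + q" by (simp add: q_def)
    have pq: "p \<bullet> q = 0" using p by (auto simp: q_def orthogonal_comp_def orthogonal_def)
    have Tp: "norm (T p) = norm p" using H_iff p by blast
    have TpTq: "T p \<bullet> T q = 0" using contraction_orthogonal_image[of T p q] assms(1) Tp pq by simp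
    have "norm (T q) \<le> restriction_norm T (H\<^sup>\<bottom>) * norm q"
      using p by (auto simp: q_def intro: norm_le_restriction_norm)
    also have "\<dots> \<le> r * norm q" by (intro mult_right_mono) (auto simp: r_def)
    finally have "(norm (T q))\<^sup>2 \<le> r\<^sup>2 * (norm q)\<^sup>2"
      using power_mono[of "norm (T q)" "r * norm q" 2] by (simp add: power_mult_distrib)
    moreover have "(norm p)\<^sup>2 + (norm q)\<^sup>2 = 1"
      using norm_add_scaleR_squared[of p 1 q] x pq by (simp add: x_eq)
    moreover have "(norm (T x))\<^sup>2 = (norm p)\<^sup>2 + (norm (T q))\<^sup>2"
      using norm_add_scaleR_squared[of "T p" 1 "T q"] TpTq Tp
      by (simp add: x_eq blinfun.bilinear_simps)
    moreover have "1 - 2 * \<delta> < (norm (T x))\<^sup>2"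
    proof -
      have "1 - 2 * \<delta> \<le> (1 - \<delta>)\<^sup>2" by (simp add: power2_diff)
      also have "\<dots> < (norm (T x))\<^sup>2" using x \<delta> by (intro power_strict_mono) auto
      finally show ?thesis .
    qed
    ultimately have "(1 - r\<^sup>2) * (norm q)\<^sup>2 < 2 * \<delta>" by (simp add: algebra_simps)
    then have "(1 - r\<^sup>2) * (norm q)\<^sup>2 < (1 - r\<^sup>2) * \<eta>\<^sup>2" using \<delta> by linarith
    then have "(norm q)\<^sup>2 < \<eta>\<^sup>2" using r2 by simp
    then have q: "norm q < \<eta>" using \<eta> by (simp add: power_less_imp_less_base)
    have p_ge: "1 - norm q \<le> norm p" using norm_triangle_ineq[of p q] x by (simp add: x_eq)
    have "(norm p)\<^sup>2 \<le> 1\<^sup>2"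
      using \<open>(norm p)\<^sup>2 + (norm q)\<^sup>2 = 1\<close> zero_le_power2[of "norm q"] unfolding one_power2 by linarith
    then have p_le: "norm p \<le> 1" by (rule power2_le_imp_le) simp
    have "p \<noteq> 0" using p_ge q \<eta> by auto
    define u where "u = p /\<^sub>R norm p"
    have "u \<in> norm_attaining_set T"
      using \<open>p \<noteq> 0\<close> p assms by (auto simp: u_def subspace_scale)
    moreover have "norm (u - x) < \<epsilon>"
    proof -
      have "norm (u - p) = norm ((inverse (norm p) - 1) *\<^sub>R p)"
        by (simp add: u_def algebra_simps)
      also have "\<dots> = \<bar>(inverse (norm p) - 1) * norm p\<bar>" by (simp add: abs_mult)
      also have "\<dots> = \<bar>1 - norm p\<bar>" using \<open>p \<noteq> 0\<close> by (simp add: algebra_simps)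
      finally have "norm (u - p) \<le> norm q" using p_ge p_le by simp
      moreover have "norm (u - x) \<le> norm (u - p) + norm q"
        using norm_triangle_ineq4[of "u - p" q] by (simp add: x_eq algebra_simps)
      ultimately show ?thesis using q \<eta> by linarith
    qed
    ultimately show ?thesis by blast
  qed
  then show ?thesis using \<delta>(1) by (intro exI[of _ \<delta>]) simp
qed

text \<open>Since \<open>R\<close> is isometric, \<open>A\<close> and \<open>T\<close> have the same
  norm at every vector and so the same norm-attaining set; the \<open>\<delta>\<close> found for
  \<open>T\<close> itself then serves for \<open>A\<close>.\<close>

lemma uniform_BPB_rotation_exists:
  fixes T :: "'a::{real_inner, complete_space} \<Rightarrow>\<^sub>L 'b::real_inner"
  assumes "\<exists>B::'b set. independent B \<and> card B > 1" "norm T = 1"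
    and "subspace H" "norm_attaining_set T = sphere 0 1 \<inter> H"
    and "restriction_norm T (H\<^sup>\<bottom>) < 1" "\<epsilon> > 0"
  shows "\<exists>A. nontrivial_uniform_BPB_approx \<epsilon> T A \<and> norm_attaining_set T = norm_attaining_set A"
proof -
  \<comment> \<open>Otherwise the complement of \<open>H\<close> is the whole space, and the
    restriction bound contradicts \<open>norm T = 1\<close>.\<close>
  have "\<exists>x\<in>H. x \<noteq> 0"
  proof (rule ccontr)
    assume "\<not> ?thesis"
    then have "H = {0}" using assms(3) by (auto simp: subspace_0)
    then have "norm (T z) \<le> max 0 (restriction_norm T (H\<^sup>\<bottom>)) * norm z" for z
      using order_trans[OF norm_le_restriction_norm[of z "H\<^sup>\<bottom>" T] mult_right_mono] by simp
    then have "norm T \<le> max 0 (restriction_norm T (H\<^sup>\<bottom>))" by (intro norm_blinfun_bound) auto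
    then show False using assms by simp
  qed
  then obtain h where h: "h \<in> norm_attaining_set T"
    using assms(3,4) by (metis IntI mem_sphere_0 norm_sgn sgn_div_norm subspace_scale)
  then have "norm (T h) = 1" using assms(2) by (simp add: norm_attaining_set_def)
  \<comment> \<open>Half of \<open>\<epsilon>\<close> turns the non-strict bound into a strict one;
    moving \<open>T h\<close> ensures \<open>A \<noteq> T\<close>.\<close>
  then obtain R where R: "bounded_linear R" "\<And>y. norm (R y) = norm y"
      "\<And>y. norm (R y - y) \<le> \<epsilon> / 2 * norm y" "R (T h) \<noteq> T h"
    using small_rotation[OF assms(1), of "T h" "\<epsilon> / 2"] assms(6) by auto
  define A where "A = Blinfun R o\<^sub>L T"
  have A: "A x = R (T x)" for x by (simp add: A_def bounded_linear_Blinfun_apply R(1))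
  have "norm A = norm T"
    using h by (intro norm_blinfun_eqI[of _ _ h])
      (auto simp: A R norm_blinfun norm_attaining_set_def)
  then have same: "norm_attaining_set A = norm_attaining_set T"
    by (simp add: norm_attaining_set_def A R)
  have "norm (T - A) \<le> \<epsilon> / 2"
  proof (rule norm_blinfun_bound)
    show "norm ((T - A) x) \<le> \<epsilon> / 2 * norm x" for x
    proof -
      have "norm ((T - A) x) \<le> \<epsilon> / 2 * norm (T x)"
        using R(3)[of "T x"] by (simp add: A blinfun.bilinear_simps norm_minus_commute)
      also have "\<dots> \<le> \<epsilon> / 2 * norm x"
        using norm_blinfun[of T x] assms by (intro mult_left_mono) auto
      finally show ?thesis .
    qed
  qed (use assms in simp)
  then have "uniform_BPB_approx \<epsilon> T A"
    using near_norm_attaining[OF assms(2-6)] assms(2,6) \<open>norm A = norm T\<close>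
    by (simp add: uniform_BPB_approx_def same)
  moreover have "A \<noteq> T" using R(4) A by metis
  ultimately show ?thesis using same by (auto simp: nontrivial_uniform_BPB_approx_def)
qed

theorem theorem5p2:
  fixes T :: "'a::{real_inner, complete_space} \<Rightarrow>\<^sub>L 'b::{real_inner, complete_space}"
    and H\<^sub>0 :: "'a set"
  assumes "\<exists>B::'b set. independent B \<and> card B > 1"
    and "T \<in> sphere 0 1"
    and "subspace H\<^sub>0"
    and "norm_attaining_set T = sphere 0 1 \<inter> H\<^sub>0"
  shows "(\<forall>\<epsilon>>0. \<exists>A. nontrivial_uniform_BPB_approx \<epsilon> T A \<and> norm_attaining_set T = norm_attaining_set A)
    \<longleftrightarrow> restriction_norm T (H\<^sub>0\<^sup>\<bottom>) < 1"
proof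
  assume "\<forall>\<epsilon>>0. \<exists>A. nontrivial_uniform_BPB_approx \<epsilon> T A \<and> norm_attaining_set T = norm_attaining_set A"
  \<comment> \<open>Radius 1 lies below the distance \<open>sqrt 2\<close> of orthogonal unit
    vectors.\<close>
  then obtain A where "uniform_BPB_approx 1 T A" "norm_attaining_set T = norm_attaining_set A"
    unfolding nontrivial_uniform_BPB_approx_def by (meson zero_less_one)
  then show "restriction_norm T (H\<^sub>0\<^sup>\<bottom>) < 1"
    using assms(4) by (intro restriction_norm_less_1_if_uniform_BPB) auto
next
  assume "restriction_norm T (H\<^sub>0\<^sup>\<bottom>) < 1"
  then show "\<forall>\<epsilon>>0. \<exists>A. nontrivial_uniform_BPB_approx \<epsilon> T A \<and> norm_attaining_set T = norm_attaining_set A"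
    using uniform_BPB_rotation_exists[OF assms(1) _ assms(3,4)] assms(2) by simp
qed

end
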